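(* Let $R$ be a ring and $a\in R$. Then $a$ has at most one generalized Hirano inverse in $R$, and if the generalized Hirano inverse $a^{h}$ of $a$ exists, it is exactly the generalized Drazin inverse of $a$, i.e., $a^{h}=a^{d}$.
   Context: Rings are associative with identity; $U(R)$ is the group of units of $R$. For $a\in R$: $comm(a)=\{x\in R : xa=ax\}$ and $comm^2(a)=\{x\in R : xy=yx \text{ for all } y\in comm(a)\}$. $R^{qnil}=\{a\in R : 1+ax\in U(R)\text{ for every }x\in comm(a)\}$. A generalized Hirano inverse of $a\in R$ is an element $b\in R$ such that $b=bab$, $b\in comm^2(a)$ and $a^2-ab\in R^{qnil}$; it is denoted $a^h$. A generalized Drazin inverse of $a\in R$ is an element $b\in R$ such that $b=bab$, $b\in comm^2(a)$ and $a-a^2b\in R^{qnil}$; it is known to be unique when it exists, and is denoted $a^d$. *)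

theory Defs
  imports "HOL-Algebra.Ring"
begin

definition comm :: "('a, 'b) ring_scheme \<Rightarrow> 'a \<Rightarrow> 'a set" where
  "comm R a = {x \<in> carrier R. x \<otimes>\<^bsub>R\<^esub> a = a \<otimes>\<^bsub>R\<^esub> x}"

definition comm2 :: "('a, 'b) ring_scheme \<Rightarrow> 'a \<Rightarrow> 'a set" where
  "comm2 R a = {x \<in> carrier R. \<forall>y \<in> comm R a. x \<otimes>\<^bsub>R\<^esub> y = y \<otimes>\<^bsub>R\<^esub> x}"

definition qnil :: "('a, 'b) ring_scheme \<Rightarrow> 'a set" where
  "qnil R = {a \<in> carrier R. \<forall>x \<in> comm R a. \<one>\<^bsub>R\<^esub> \<oplus>\<^bsub>R\<^esub> a \<otimes>\<^bsub>R\<^esub> x \<in> Units R}"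

definition is_gen_Hirano_inverse :: "('a, 'b) ring_scheme \<Rightarrow> 'a \<Rightarrow> 'a \<Rightarrow> bool" where
  "is_gen_Hirano_inverse R a b \<longleftrightarrow>
     b \<in> carrier R \<and>
     b = b \<otimes>\<^bsub>R\<^esub> a \<otimes>\<^bsub>R\<^esub> b \<and>
     b \<in> comm2 R a \<and>
     a [^]\<^bsub>R\<^esub> (2::nat) \<ominus>\<^bsub>R\<^esub> a \<otimes>\<^bsub>R\<^esub> b \<in> qnil R"

definition is_gen_Drazin_inverse :: "('a, 'b) ring_scheme \<Rightarrow> 'a \<Rightarrow> 'a \<Rightarrow> bool" where
  "is_gen_Drazin_inverse R a b \<longleftrightarrow>
     b \<in> carrier R \<and>
     b = b \<otimes>\<^bsub>R\<^esub> a \<otimes>\<^bsub>R\<^esub> b \<and>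
     b \<in> comm2 R a \<and>
     a \<ominus>\<^bsub>R\<^esub> a [^]\<^bsub>R\<^esub> (2::nat) \<otimes>\<^bsub>R\<^esub> b \<in> qnil R"

text \<open>
  The elements written $a^h$ and $a^d$. They are meaningful only when exactly one
  inverse of the respective kind exists.
\<close>

definition gen_Hirano_inverse :: "('a, 'b) ring_scheme \<Rightarrow> 'a \<Rightarrow> 'a" where
  "gen_Hirano_inverse R a = (THE b. is_gen_Hirano_inverse R a b)"

definition gen_Drazin_inverse :: "('a, 'b) ring_scheme \<Rightarrow> 'a \<Rightarrow> 'a" where
  "gen_Drazin_inverse R a = (THE b. is_gen_Drazin_inverse R a b)"

end

theory Submission
  imports Defs
begin

text \<open>
  If \<open>b\<close> is a generalized Hirano inverse of \<open>a\<close>, then \<open>e = 1 - ab\<close> is an idempotent commuting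
  with \<open>a\<close>, and \<open>w = a - a\<^sup>2b = ae\<close> satisfies \<open>w\<^sup>2 = ne\<close> with \<open>n = a\<^sup>2 - ab\<close> quasinilpotent.
  For \<open>x\<close> commuting with \<open>w\<close>, the corner element \<open>y = exe\<close> commutes with both \<open>w\<close> and \<open>n\<close>, and
  \<open>wx = wy\<close>. Thus \<open>(1 + wy)(1 - wy) = 1 - ny\<^sup>2\<close> is a unit, and so is \<open>1 + wx\<close>. Hence every
  generalized Hirano inverse is a generalized Drazin inverse.

  If \<open>b\<close> and \<open>c\<close> are generalized Drazin inverses of \<open>a\<close>, the idempotent \<open>ab(1 - ac) = (a - a\<^sup>2c)b\<close>
  has a unit as its complement, so it vanishes; by symmetry \<open>ab = ac\<close>, whence \<open>b = c\<close>.
\<close>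

text \<open>If \<open>z\<close> inverts \<open>u \<otimes> v\<close>, then
  \<open>v \<otimes> z\<close> is a right inverse of \<open>u\<close> and, because the factors
  commute, \<open>z \<otimes> v\<close> is a left inverse; the two must coincide.\<close>

lemma (in monoid) commuting_factor_Units:
  assumes "u \<in> carrier G" "v \<in> carrier G" "u \<otimes> v = v \<otimes> u" "u \<otimes> v \<in> Units G"
  shows "u \<in> Units G"
proof -
  obtain z where z: "z \<in> carrier G" "z \<otimes> (u \<otimes> v) = \<one>" "(u \<otimes> v) \<otimes> z = \<one>"
    using assms(4) by (auto simp: Units_def)
  have r: "u \<otimes> (v \<otimes> z) = \<one>" using z(1,3) assms(1,2) by (simp add: m_assoc)
  have l: "(z \<otimes> v) \<otimes> u = \<one>" using z assms by (simp add: m_assoc)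
  have "z \<otimes> v = v \<otimes> z" using inv_unique[OF l r] z assms by simp
  then show ?thesis using r l z assms by (auto simp: Units_def)
qed

context ring
begin

lemma one_plus_mult_one_minus:
  assumes "t \<in> carrier R"
  shows "(\<one> \<oplus> t) \<otimes> (\<one> \<ominus> t) = \<one> \<ominus> t \<otimes> t" "(\<one> \<ominus> t) \<otimes> (\<one> \<oplus> t) = \<one> \<ominus> t \<otimes> t"
  using assms by (simp_all add: minus_eq l_distr r_distr l_minus r_minus a_assoc minus_add r_neg1 r_neg2)

lemma minus_idempotent:
  assumes "p \<in> carrier R" "p \<otimes> p = p"
  shows "(\<one> \<ominus> p) \<otimes> (\<one> \<ominus> p) = \<one> \<ominus> p" "p \<otimes> (\<one> \<ominus> p) = \<zero>" "(\<one> \<ominus> p) \<otimes> p = \<zero>"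
  using assms by (simp_all add: minus_eq l_distr r_distr l_minus r_minus a_assoc r_neg l_neg minus_add)

lemma idempotent_complement_Unit_imp_zero:
  assumes "p \<in> carrier R" "p \<otimes> p = p" "\<one> \<ominus> p \<in> Units R"
  shows "p = \<zero>"
proof -
  obtain z where z: "z \<in> carrier R" "(\<one> \<ominus> p) \<otimes> z = \<one>"
    using assms(3) by (auto simp: Units_def)
  have "p = p \<otimes> ((\<one> \<ominus> p) \<otimes> z)" using z assms by simp
  also have "\<dots> = (p \<otimes> (\<one> \<ominus> p)) \<otimes> z" using z assms by (simp add: m_assoc)
  also have "\<dots> = \<zero>" using minus_idempotent z assms by simp
  finally show ?thesis .
qed

lemma comm2_commute: "a \<in> carrier R \<Longrightarrow> b \<in> comm2 R a \<Longrightarrow> b \<otimes> a = a \<otimes> b"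
  by (auto simp: comm2_def comm_def)

text \<open>On the corner cut out by \<open>e\<close>, \<open>n\<close> acts as the square of
  \<open>a\<close>, so quasinilpotence passes from that square to its root
  \<open>a \<otimes> e\<close>.\<close>

lemma qnil_from_Peirce_corner:
  assumes a: "a \<in> carrier R" and e: "e \<in> carrier R" "e \<otimes> e = e" "e \<otimes> a = a \<otimes> e"
    and n: "n \<in> qnil R" "n \<otimes> e = a \<otimes> a \<otimes> e" "e \<otimes> n = a \<otimes> a \<otimes> e"
  shows "a \<otimes> e \<in> qnil R"
proof -
  define w where "w = a \<otimes> e"
  have [simp]: "a \<in> carrier R" "e \<in> carrier R" "n \<in> carrier R" "w \<in> carrier R"
    using a e n by (auto simp: qnil_def w_def)
  have we: "w \<otimes> e = w" by (simp add: w_def m_assoc e)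
  have ew: "e \<otimes> w = w" using m_assoc[of e a e] by (simp add: w_def e m_assoc)
  have ww: "w \<otimes> w = a \<otimes> a \<otimes> e" using ew by (simp add: w_def m_assoc)
  have "\<one> \<oplus> w \<otimes> x \<in> Units R" if "x \<in> comm R w" for x
  proof -
    have [simp]: "x \<in> carrier R" and xw: "x \<otimes> w = w \<otimes> x" using that by (auto simp: comm_def)
    \<comment> \<open>An \<open>x\<close> commuting with \<open>w\<close> need not commute with
      \<open>n\<close>, whose part outside the corner is unrelated to \<open>w\<close>. Compressing
      by \<open>e\<close> on both sides makes that part irrelevant.\<close>
    define y where "y = e \<otimes> x \<otimes> e"
    have [simp]: "y \<in> carrier R" by (simp add: y_def)
    have ye: "y \<otimes> e = y" by (simp add: y_def m_assoc e)
    have ey: "e \<otimes> y = y" using m_assoc[of e e "x \<otimes> e"] by (simp add: y_def m_assoc e)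
    have "y \<otimes> w = e \<otimes> (x \<otimes> w)" by (simp add: y_def m_assoc ew)
    also have "\<dots> = (e \<otimes> w) \<otimes> x" by (simp add: xw m_assoc)
    finally have yw: "y \<otimes> w = w \<otimes> x" by (simp add: ew)
    have "w \<otimes> y = (w \<otimes> e) \<otimes> x \<otimes> e" by (simp add: y_def m_assoc)
    also have "\<dots> = x \<otimes> (w \<otimes> e)" by (simp add: we xw[symmetric] m_assoc)
    finally have wy: "w \<otimes> y = w \<otimes> x" by (simp add: we xw)
    have "n \<otimes> y = (n \<otimes> e) \<otimes> y" by (simp add: m_assoc ey)
    then have ny: "n \<otimes> y = w \<otimes> (w \<otimes> y)" by (simp add: n ww[symmetric] m_assoc)
    have "y \<otimes> n = y \<otimes> (e \<otimes> n)" using m_assoc[of y e n] by (simp add: ye)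
    also have "\<dots> = (y \<otimes> w) \<otimes> w" by (simp add: n ww[symmetric] m_assoc)
    also have "\<dots> = w \<otimes> (y \<otimes> w)" by (simp add: yw wy[symmetric] m_assoc)
    finally have yn: "y \<otimes> n = n \<otimes> y" by (simp add: ny yw wy)
    have "y \<otimes> y \<otimes> n = n \<otimes> (y \<otimes> y)"
      using m_assoc[of y n y] m_assoc[of n y y] by (simp add: yn m_assoc)
    \<comment> \<open>This test element turns the defining condition on \<open>n\<close> into
      invertibility of 1 - (wy)^2, a difference of squares.\<close>
    then have "\<ominus> (y \<otimes> y) \<in> comm R n" by (simp add: comm_def l_minus r_minus)
    then have "\<one> \<oplus> n \<otimes> (\<ominus> (y \<otimes> y)) \<in> Units R" using n(1) by (auto simp: qnil_def)
    moreover have "n \<otimes> (y \<otimes> y) = (w \<otimes> y) \<otimes> (w \<otimes> y)"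
    proof -
      have "n \<otimes> (y \<otimes> y) = (w \<otimes> (w \<otimes> y)) \<otimes> y" by (simp add: m_assoc[symmetric] ny)
      also have "w \<otimes> y = y \<otimes> w" by (simp add: yw wy)
      finally show ?thesis by (simp add: m_assoc)
    qed
    ultimately have "(\<one> \<oplus> w \<otimes> y) \<otimes> (\<one> \<ominus> w \<otimes> y) \<in> Units R"
      by (simp add: one_plus_mult_one_minus r_minus a_minus_def[symmetric])
    then have "\<one> \<oplus> w \<otimes> y \<in> Units R"
      \<comment> \<open>The rotation puts the unit premise first, to match the chained fact. The
        factors commute because both products are 1 - (wy)^2.\<close>
      by (rule commuting_factor_Units[rotated 3]) (simp_all add: one_plus_mult_one_minus)
    then show ?thesis by (simp add: wy)
  qed
  then show ?thesis by (simp add: qnil_def w_def[symmetric])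
qed

text \<open>The two notions differ only in the element required to be quasinilpotent, and a - a^2 b
  is the corner element a(1 - ab).\<close>

lemma gen_Hirano_imp_gen_Drazin:
  assumes a[simp]: "a \<in> carrier R" and H: "is_gen_Hirano_inverse R a b"
  shows "is_gen_Drazin_inverse R a b"
proof -
  have [simp]: "b \<in> carrier R" and bab: "b \<otimes> a \<otimes> b = b" and ba: "b \<otimes> a = a \<otimes> b"
    and n: "a [^] (2::nat) \<ominus> a \<otimes> b \<in> qnil R"
    using H comm2_commute[OF a] by (auto simp: is_gen_Hirano_inverse_def)
  define p where "p = a \<otimes> b"
  have p[simp]: "p \<in> carrier R" by (simp add: p_def)
  have pp: "p \<otimes> p = p" using bab by (simp add: p_def m_assoc)
  have pa: "p \<otimes> a = a \<otimes> p" by (simp add: p_def m_assoc ba)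
  have sq: "a [^] (2::nat) = a \<otimes> a" by (simp add: numeral_2_eq_2)
  define e where "e = \<one> \<ominus> p"
  have e[simp]: "e \<in> carrier R" by (simp add: e_def)
  note id = minus_idempotent[OF p pp, folded e_def]
  have ea: "e \<otimes> a = a \<otimes> e" by (simp add: e_def minus_eq l_distr r_distr l_minus r_minus pa)
  have eaa: "e \<otimes> (a \<otimes> a) = a \<otimes> a \<otimes> e"
    using m_assoc[of e a a] m_assoc[of a e a] by (simp add: ea m_assoc)
  have "a \<otimes> e \<in> qnil R"
  proof (rule qnil_from_Peirce_corner[OF a e id(1) ea])
    show "a \<otimes> a \<ominus> p \<in> qnil R" using n by (simp add: sq p_def)
    \<comment> \<open>\<open>p\<close> and \<open>e\<close> annihilate each other, so only the
      square of \<open>a\<close> survives in the corner.\<close>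
    show "(a \<otimes> a \<ominus> p) \<otimes> e = a \<otimes> a \<otimes> e" "e \<otimes> (a \<otimes> a \<ominus> p) = a \<otimes> a \<otimes> e"
      using id by (simp_all add: minus_eq l_distr r_distr l_minus r_minus eaa)
  qed
  moreover have "a \<otimes> e = a \<ominus> a [^] (2::nat) \<otimes> b"
    by (simp add: e_def sq p_def minus_eq r_distr r_minus m_assoc)
  ultimately show ?thesis
    using H by (simp add: is_gen_Hirano_inverse_def is_gen_Drazin_inverse_def)
qed

text \<open>This is one half of the equality of the idempotents \<open>p = a \<otimes> b\<close> and
  \<open>q = a \<otimes> c\<close>: \<open>p\<close> lies below \<open>q\<close>. A quasinilpotent
  times an element commuting with it cannot be a nonzero idempotent, which rules out p(1 -
  q).\<close>

lemma gen_Drazin_idempotent_absorb: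
  assumes a[simp]: "a \<in> carrier R"
    and b: "is_gen_Drazin_inverse R a b" and c: "is_gen_Drazin_inverse R a c"
  shows "a \<otimes> b = (a \<otimes> b) \<otimes> (a \<otimes> c)"
proof -
  have [simp]: "b \<in> carrier R" "c \<in> carrier R"
    and ba: "b \<otimes> a = a \<otimes> b" and ca: "c \<otimes> a = a \<otimes> c"
    and bab: "b \<otimes> a \<otimes> b = b" and cac: "c \<otimes> a \<otimes> c = c"
    and w: "a \<ominus> a [^] (2::nat) \<otimes> c \<in> qnil R"
    using b c comm2_commute[OF a] by (auto simp: is_gen_Drazin_inverse_def)
  \<comment> \<open>\<open>c\<close> commutes with \<open>a\<close>, and \<open>b\<close> lies in
    the double commutant of \<open>a\<close>.\<close>
  have bc: "b \<otimes> c = c \<otimes> b"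
    using b ca by (auto simp: is_gen_Drazin_inverse_def comm2_def comm_def)
  define p where "p = a \<otimes> b"
  define q where "q = a \<otimes> c"
  have p[simp]: "p \<in> carrier R" and q[simp]: "q \<in> carrier R" by (simp_all add: p_def q_def)
  have pp: "p \<otimes> p = p" using bab by (simp add: p_def m_assoc)
  have qq: "q \<otimes> q = q" using cac by (simp add: q_def m_assoc)
  have bq: "b \<otimes> q = q \<otimes> b"
    using m_assoc[of b a c] by (simp add: q_def m_assoc ba bc)
  have aq: "a \<otimes> q = q \<otimes> a" by (simp add: q_def m_assoc ca)
  define f where "f = \<one> \<ominus> q"
  have f[simp]: "f \<in> carrier R" by (simp add: f_def)
  have ff: "f \<otimes> f = f" using minus_idempotent[OF q qq] by (simp add: f_def)
  have bf: "b \<otimes> f = f \<otimes> b" by (simp add: f_def minus_eq l_distr r_distr l_minus r_minus bq)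
  have af: "a \<otimes> f = f \<otimes> a" by (simp add: f_def minus_eq l_distr r_distr l_minus r_minus aq)
  have pf: "p \<otimes> f = f \<otimes> p"
    using m_assoc[of a f b] m_assoc[of f a b] by (simp add: p_def m_assoc bf af)
  have w_eq: "a \<ominus> a [^] (2::nat) \<otimes> c = a \<otimes> f"
    by (simp add: f_def numeral_2_eq_2 q_def minus_eq r_distr r_minus m_assoc)
  have "b \<otimes> (a \<otimes> f) = (a \<otimes> f) \<otimes> b"
    using m_assoc[of b a f] by (simp add: ba m_assoc bf)
  \<comment> \<open>Testing against \<open>\<ominus> b\<close> makes the resulting unit exactly 1 -
    pf.\<close>
  then have "\<ominus> b \<in> comm R (a \<otimes> f)" by (simp add: comm_def l_minus r_minus)
  then have "\<one> \<oplus> (a \<otimes> f) \<otimes> (\<ominus> b) \<in> Units R" using w by (auto simp: qnil_def w_eq)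
  moreover have "(a \<otimes> f) \<otimes> b = p \<otimes> f" by (simp add: p_def m_assoc bf)
  ultimately have unit: "\<one> \<ominus> p \<otimes> f \<in> Units R" by (simp add: r_minus minus_eq)
  have "(p \<otimes> f) \<otimes> (p \<otimes> f) = p \<otimes> (f \<otimes> p) \<otimes> f" by (simp add: m_assoc)
  also have "\<dots> = (p \<otimes> p) \<otimes> (f \<otimes> f)" by (simp add: pf[symmetric] m_assoc)
  finally have "(p \<otimes> f) \<otimes> (p \<otimes> f) = p \<otimes> f" by (simp add: pp ff)
  then have "p \<otimes> f = \<zero>" using unit by (intro idempotent_complement_Unit_imp_zero) simp_all
  then have "p \<ominus> p \<otimes> q = \<zero>" by (simp add: f_def minus_eq r_distr r_minus)
  then show ?thesis using minus_equality[of p "\<ominus> (p \<otimes> q)"]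
    by (simp add: p_def[symmetric] q_def[symmetric] minus_eq)
qed

lemma gen_Drazin_inverse_unique:
  assumes a[simp]: "a \<in> carrier R"
    and b: "is_gen_Drazin_inverse R a b" and c: "is_gen_Drazin_inverse R a c"
  shows "b = c"
proof -
  have [simp]: "b \<in> carrier R" "c \<in> carrier R"
    and ba: "b \<otimes> a = a \<otimes> b" and ca: "c \<otimes> a = a \<otimes> c"
    and bab: "b \<otimes> a \<otimes> b = b" and cac: "c \<otimes> a \<otimes> c = c"
    using b c comm2_commute[OF a] by (auto simp: is_gen_Drazin_inverse_def)
  have bc: "b \<otimes> c = c \<otimes> b"
    using b ca by (auto simp: is_gen_Drazin_inverse_def comm2_def comm_def)
  have "b \<otimes> (a \<otimes> c) = c \<otimes> (a \<otimes> b)"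
    using m_assoc[of b a c] m_assoc[of c a b] by (simp add: ba ca m_assoc bc)
  then have comm: "(a \<otimes> b) \<otimes> (a \<otimes> c) = (a \<otimes> c) \<otimes> (a \<otimes> b)" by (simp add: m_assoc)
  \<comment> \<open>Absorption in both directions gives p = pq = qp = q.\<close>
  have pq: "a \<otimes> b = a \<otimes> c"
    using gen_Drazin_idempotent_absorb[OF a b c] gen_Drazin_idempotent_absorb[OF a c b] comm
    by simp
  have "b = b \<otimes> (a \<otimes> b)" using bab by (simp add: m_assoc)
  also have "\<dots> = (b \<otimes> a) \<otimes> c" by (simp add: pq m_assoc)
  also have "\<dots> = (c \<otimes> a) \<otimes> c" by (simp add: ba ca pq)
  finally show ?thesis by (simp add: cac)
qed

end

theorem corollary2p3:
  fixes R :: "('a, 'b) ring_scheme" and a :: 'a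
  assumes "ring R" and "a \<in> carrier R"
  shows "(\<forall>b c. is_gen_Hirano_inverse R a b \<and> is_gen_Hirano_inverse R a c \<longrightarrow> b = c) \<and>
    ((\<exists>b. is_gen_Hirano_inverse R a b) \<longrightarrow>
       (\<exists>!d. is_gen_Drazin_inverse R a d) \<and>
       gen_Hirano_inverse R a = gen_Drazin_inverse R a)"
proof (intro conjI impI allI)
  note drazin = ring.gen_Hirano_imp_gen_Drazin[OF assms]
  note unique = ring.gen_Drazin_inverse_unique[OF assms]
  show "b = c" if "is_gen_Hirano_inverse R a b \<and> is_gen_Hirano_inverse R a c" for b c
    using that drazin unique by blast
  assume "\<exists>b. is_gen_Hirano_inverse R a b"
  then obtain b where b: "is_gen_Hirano_inverse R a b" ..
  show "\<exists>!d. is_gen_Drazin_inverse R a d" using drazin[OF b] unique by blast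
  \<comment> \<open>Each \<open>THE\<close> is resolved by the same witness \<open>b\<close>;
    uniqueness on the Hirano side is inherited from the Drazin side.\<close>
  have "gen_Hirano_inverse R a = b" unfolding gen_Hirano_inverse_def
    using b drazin unique by (intro the_equality) blast+
  moreover have "gen_Drazin_inverse R a = b" unfolding gen_Drazin_inverse_def
    using drazin[OF b] unique by (intro the_equality) blast+
  ultimately show "gen_Hirano_inverse R a = gen_Drazin_inverse R a" by simp
qed

end
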